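(* Let $p_1,\dots,p_\ell$ be distinct primes congruent to $1$ mod $4$, let $L=\mathbb{Q}(\sqrt{p_1},\dots,\sqrt{p_\ell})$, let $\mathcal{S}_0$ be a finite subset of $O_L^*\cap(1+4O_L)$ whose images in the $\mathbb{Z}/2$-vector space $O_L^*/(O_L^* )^2$ are linearly independent, and let $N=L(\sqrt w: w\in\mathcal{S}_0)$. For $D\subset\{1,\dots,\ell\}$ put $\lambda_D=\prod_{i\in D}\frac{1+\sqrt{p_i}}{2}$ and for $T\subset\mathcal{S}_0$ put $\eta_T=\prod_{w\in T}\frac{1+\sqrt w}{2}$. Then: (i) $\{\lambda_D: D\subset\{1,\dots,\ell\}\}$ is a $\mathbb{Z}$-basis of $O_L$; (ii) $\{\eta_T:T\subset\mathcal{S}_0\}$ is a basis of $O_N$ as a free $O_L$-module; (iii) $\{\eta_T\lambda_D: T\subset\mathcal{S}_0,\ D\subset\{1,\dots,\ell\}\}$ is a $\mathbb{Z}$-basis of $O_N$. *)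

theory Defs
  imports Complex_Main "HOL-Computational_Algebra.Polynomial"
    "HOL-Computational_Algebra.Primes" "HOL-Algebra.Algebra" "HOL-Algebra.Algebraic_Closure_Type"
begin

abbreviation complex_ring :: "complex ring" where
  "complex_ring \<equiv> ring_of_type_algebra"

text \<open>Number fields are taken as subfields of the complex numbers.\<close>

definition adjoin :: "complex set \<Rightarrow> complex set \<Rightarrow> complex set" where
  "adjoin K A = generate_field complex_ring (K \<union> A)"

definition integers_of :: "complex set \<Rightarrow> complex set" where
  "integers_of K = {x \<in> K. algebraic_int x}"

definition integer_ring :: "complex set \<Rightarrow> complex ring" where
  "integer_ring K = complex_ring\<lparr>carrier := integers_of K\<rparr>"

definition unit_squares :: "('a, 'b) ring_scheme \<Rightarrow> 'a set" where
  "unit_squares R = (\<lambda>u. u [^]\<^bsub>units_of R\<^esub> (2::nat)) ` carrier (units_of R)"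

definition unit_square_classes :: "('a, 'b) ring_scheme \<Rightarrow> 'a set monoid" where
  "unit_square_classes R = units_of R Mod unit_squares R"

text \<open>
  A commutative group in which every square is trivial is a vector space over the field with
  two elements, the scalar action being exponentiation by the representatives 0 and 1.  The
  following is linear independence of a finite family in this vector space, which is written
  multiplicatively.
\<close>

definition Z2_independent_family :: "('a, 'b) monoid_scheme \<Rightarrow> 'i set \<Rightarrow> ('i \<Rightarrow> 'a) \<Rightarrow> bool" where
  "Z2_independent_family V I v \<longleftrightarrow> finite I \<and> v ` I \<subseteq> carrier V \<and>
     (\<forall>c \<in> I \<rightarrow> {0, 1::nat}.
        (\<Otimes>\<^bsub>V\<^esub>i\<in>I. v i [^]\<^bsub>V\<^esub> c i) = \<one>\<^bsub>V\<^esub> \<longrightarrow> (\<forall>i\<in>I. c i = 0))"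

text \<open>
  A finite family \<open>b\<close> is a basis of the \<open>R\<close>-module \<open>M\<close>, where \<open>R\<close> is a subring of the ambient ring
  and acts on \<open>M\<close> by multiplication.  As families are used throughout, distinct indices
  give distinct basis elements.
\<close>

definition basis_family :: "'a::comm_ring_1 set \<Rightarrow> 'a set \<Rightarrow> 'i set \<Rightarrow> ('i \<Rightarrow> 'a) \<Rightarrow> bool" where
  "basis_family R M I b \<longleftrightarrow> finite I \<and> b ` I \<subseteq> M \<and>
     (\<forall>x\<in>M. \<exists>c \<in> I \<rightarrow> R. x = (\<Sum>i\<in>I. c i * b i)) \<and>
     (\<forall>c \<in> I \<rightarrow> R. (\<Sum>i\<in>I. c i * b i) = 0 \<longrightarrow> (\<forall>i\<in>I. c i = 0))"

lemma unit_square_classes_vector_space: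
  assumes "cring R"
  shows "comm_group (unit_square_classes R)"
    and "\<And>x. x \<in> carrier (unit_square_classes R) \<Longrightarrow>
           x \<otimes>\<^bsub>unit_square_classes R\<^esub> x = \<one>\<^bsub>unit_square_classes R\<^esub>"
proof -
  interpret R: cring R by fact
  interpret U: comm_group "units_of R" by (rule R.units_comm_group)
  have "(\<lambda>u. u [^]\<^bsub>units_of R\<^esub> (2::nat)) \<in> hom (units_of R) (units_of R)"
    by (auto simp: hom_def U.pow_mult_distrib U.m_comm)
  then interpret h: group_hom "units_of R" "units_of R" "\<lambda>u. u [^]\<^bsub>units_of R\<^esub> (2::nat)"
    by unfold_locales
  have sub: "subgroup (unit_squares R) (units_of R)"
    unfolding unit_squares_def by (rule h.img_is_subgroup)
  then show "comm_group (unit_square_classes R)"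
    unfolding unit_square_classes_def by (rule U.abelian_FactGroup)
  have nrm: "unit_squares R \<lhd> units_of R"
    using sub by (rule U.subgroup_imp_normal)
  fix x assume "x \<in> carrier (unit_square_classes R)"
  then obtain u where u: "u \<in> carrier (units_of R)"
      and x: "x = unit_squares R #>\<^bsub>units_of R\<^esub> u"
    by (auto simp: unit_square_classes_def FactGroup_def RCOSETS_def)
  have "u \<otimes>\<^bsub>units_of R\<^esub> u \<in> unit_squares R"
    using u by (auto simp: unit_squares_def numeral_2_eq_2)
  then show "x \<otimes>\<^bsub>unit_square_classes R\<^esub> x = \<one>\<^bsub>unit_square_classes R\<^esub>"
    using u by (simp add: x unit_square_classes_def FactGroup_def normal.rcos_sum[OF nrm]
        U.coset_join2[OF _ sub])
qed

end

theory Submission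
  imports Defs "Jordan_Normal_Form.Char_Poly"
begin

text \<open>
  Adjoin one square root \<open>s\<close> at a time to a field \<open>K\<close>, with \<open>s\<^sup>2 \<equiv> 1\<close> modulo \<open>4\<close>, so that
  \<open>\<theta> = (1 + s) / 2\<close> is integral.  If \<open>a + b \<theta>\<close> is integral then, subtracting its conjugate, so is
  \<open>b s\<close>.  Hence the integers of \<open>K(s)\<close> are \<open>O \<oplus> O \<theta>\<close>, where \<open>O\<close> is the ring of integers of \<open>K\<close>, as
  soon as \<open>s \<notin> K\<close> and \<open>b\<^sup>2 s\<^sup>2\<close> integral implies \<open>b\<close> integral for \<open>b \<in> K\<close>.  The latter is clear if
  \<open>s\<^sup>2\<close> is a unit.  If \<open>s\<^sup>2 = p\<close> is prime, it says that \<open>p\<close> does not ramify in \<open>K\<close>; for \<open>K\<close> generated by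
  square roots of other primes this follows by induction, and \<open>b = 1 / s\<close> shows \<open>s \<notin> K\<close>.  In the unit
  case \<open>s \<notin> K\<close> is Kummer theory: an element of \<open>L\<close> that becomes a square in \<open>L(\<surd>w : w \<in> U)\<close> is a square
  in \<open>L\<close> up to a product of elements of \<open>U\<close>.
\<close>

subsection \<open>Sums and products of algebraic integers\<close>

text \<open>The characteristic polynomial of an integer matrix is monic with integer coefficients
  and vanishes at every complex eigenvalue.\<close>

lemma algebraic_int_eigenvalue:
  fixes x :: complex and A :: "int mat"
  assumes A: "A \<in> carrier_mat n n" and x: "eigenvalue (map_mat of_int A) x"
  shows "algebraic_int x"
proof -
  have "poly (char_poly (map_mat of_int A)) x = 0"
    using x A eigenvalue_root_char_poly[of "map_mat of_int A :: complex mat" n] by simp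
  hence "poly (map_poly of_int (char_poly A)) x = 0"
    by (simp add: of_int_hom.char_poly_hom[OF A])
  moreover have "lead_coeff (char_poly A) = 1"
    using degree_monic_char_poly[OF A] by auto
  ultimately show ?thesis
    by (auto simp: algebraic_int_altdef_ipoly)
qed

text \<open>The complex numbers as a module over the integers: \<open>int_span.span S\<close> is the
  additive group generated by \<open>S\<close>, the kind of lattice on which algebraic integers
  act.\<close>

interpretation int_span: Modules.module "\<lambda>(r::int) (x::complex). of_int r * x"
  by unfold_locales (auto simp: algebra_simps)

text \<open>Multiplication by \<open>x\<close> on the elements of \<open>S\<close> is described by
  an integer matrix, and the vector of these elements is itself an eigenvector for \<open>x\<close>.
  The element \<open>s0\<close> makes this vector nonzero.\<close>

lemma algebraic_int_stable_span:
  assumes fin: "finite S" and nz: "s0 \<in> S" "s0 \<noteq> 0"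
    and stab: "\<And>s. s \<in> S \<Longrightarrow> x * s \<in> int_span.span S"
  shows "algebraic_int x"
proof -
  obtain n f where f: "bij_betw f {0..<n::nat} S"
    using ex_bij_betw_nat_finite[OF fin] by blast
  have "\<exists>u. x * s = (\<Sum>t\<in>S. of_int (u t) * t)" if "s \<in> S" for s
    using stab[OF that] by (auto simp: int_span.span_finite[OF fin])
  then obtain u where u: "\<And>s. s \<in> S \<Longrightarrow> x * s = (\<Sum>t\<in>S. of_int (u s t) * t)"
    by metis
  define A where "A = mat n n (\<lambda>(i, j). u (f i) (f j))"
  define v where "v = vec n f"
  have A: "A \<in> carrier_mat n n"
    by (simp add: A_def)
  obtain k where k: "k < n" "f k = s0"
    using f nz by (metis atLeastLessThan_iff bij_betw_iff_bijections)
  have "v \<noteq> 0\<^sub>v n"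
    using k nz by (metis index_vec index_zero_vec(1) v_def)
  moreover have "map_mat of_int A *\<^sub>v v = x \<cdot>\<^sub>v v"
  proof (rule eq_vecI)
    fix i assume "i < dim_vec (x \<cdot>\<^sub>v v)"
    hence i: "i < n" by (simp add: v_def)
    have "vec_index (map_mat of_int A *\<^sub>v v) i = (\<Sum>j = 0..<n. of_int (u (f i) (f j)) * f j)"
      using i by (simp add: A_def v_def scalar_prod_def)
    also have "\<dots> = (\<Sum>t\<in>S. of_int (u (f i) t) * t)"
      by (rule sum.reindex_bij_betw[OF f])
    also have "\<dots> = x * f i"
      using f i by (subst u) (auto simp: bij_betw_def)
    finally show "vec_index (map_mat of_int A *\<^sub>v v) i = vec_index (x \<cdot>\<^sub>v v) i"
      using i by (simp add: v_def)
  qed (simp add: A_def v_def)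
  ultimately have "eigenvalue (map_mat of_int A) x"
    unfolding eigenvalue_def eigenvector_def using A by (auto simp: v_def intro!: exI[of _ v])
  thus ?thesis
    using A algebraic_int_eigenvalue by blast
qed

lemma algebraic_int_power_in_span:
  assumes "algebraic_int x"
  obtains m where "x ^ m \<in> int_span.span ((\<lambda>i. x ^ i) ` {..<m})"
proof -
  obtain q where q: "poly (map_poly of_int q) x = 0" "lead_coeff q = 1"
    using assms by (auto simp: algebraic_int_altdef_ipoly)
  define m where "m = degree q"
  have "0 = (\<Sum>i\<le>m. of_int (Polynomial.coeff q i) * x ^ i)"
    using q(1) by (simp add: poly_altdef degree_map_poly coeff_map_poly m_def)
  also have "\<dots> = (\<Sum>i<m. of_int (Polynomial.coeff q i) * x ^ i) + x ^ m"
    using q(2) by (simp add: m_def lessThan_Suc_atMost[symmetric])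
  finally have "x ^ m = - (\<Sum>i<m. of_int (Polynomial.coeff q i) * x ^ i)"
    by (simp add: eq_neg_iff_add_eq_0 add.commute)
  also have "\<dots> \<in> int_span.span ((\<lambda>i. x ^ i) ` {..<m})"
    by (intro int_span.span_neg int_span.span_sum int_span.span_scale int_span.span_base) auto
  finally show ?thesis by (rule that)
qed

lemma span_mult_stable:
  assumes "\<And>s. s \<in> S \<Longrightarrow> x * s \<in> int_span.span T" and "z \<in> int_span.span S"
  shows "x * z \<in> int_span.span T"
  using assms(2)
proof (induction rule: int_span.span_induct_alt)
  case base
  show ?case using int_span.span_zero by simp
next
  case (step c s z)
  have "x * (of_int c * s + z) = of_int c * (x * s) + x * z"
    by (simp add: algebra_simps)
  thus ?case
    using step assms(1) by (simp add: int_span.span_add int_span.span_scale)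
qed

text \<open>The finitely many monomials \<open>x ^ i * y ^ j\<close> with \<open>i < m\<close> and
  \<open>j < n\<close> generate a group that \<open>x\<close> and \<open>y\<close> map into itself,
  hence so do their sum and product. The monomial 1 is the required nonzero generator.\<close>

lemma algebraic_int_plus_times:
  fixes x y :: complex
  assumes "algebraic_int x" "algebraic_int y"
  shows "algebraic_int (x + y)" and "algebraic_int (x * y)"
proof -
  obtain m where m: "x ^ m \<in> int_span.span ((\<lambda>i. x ^ i) ` {..<m})"
    using assms(1) by (rule algebraic_int_power_in_span)
  obtain n where n: "y ^ n \<in> int_span.span ((\<lambda>i. y ^ i) ` {..<n})"
    using assms(2) by (rule algebraic_int_power_in_span)
  define S where "S = (\<lambda>(i, j). x ^ i * y ^ j) ` ({..<m} \<times> {..<n})"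
  have Sx: "x * s \<in> int_span.span S" if s: "s \<in> S" for s
  proof -
    obtain i j where ij: "i < m" "j < n" "s = x ^ i * y ^ j"
      using s by (auto simp: S_def)
    have "y ^ j * x ^ Suc i \<in> int_span.span S"
    proof (cases "Suc i < m")
      case True
      thus ?thesis
        using ij by (intro int_span.span_base) (auto simp: S_def mult.commute intro!: image_eqI[of _ _ "(Suc i, j)"])
    next
      case False
      hence "Suc i = m" using ij by simp
      moreover have "y ^ j * x ^ m \<in> int_span.span S"
        by (rule span_mult_stable[OF _ m], rule int_span.span_base) (use ij in \<open>force simp: S_def mult.commute\<close>)
      ultimately show ?thesis by simp
    qed
    thus ?thesis by (simp add: ij(3) mult_ac)
  qed
  have Sy: "y * s \<in> int_span.span S" if s: "s \<in> S" for s
  proof -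
    obtain i j where ij: "i < m" "j < n" "s = x ^ i * y ^ j"
      using s by (auto simp: S_def)
    have "x ^ i * y ^ Suc j \<in> int_span.span S"
    proof (cases "Suc j < n")
      case True
      thus ?thesis
        using ij by (intro int_span.span_base) (auto simp: S_def intro!: image_eqI[of _ _ "(i, Suc j)"])
    next
      case False
      hence "Suc j = n" using ij by simp
      moreover have "x ^ i * y ^ n \<in> int_span.span S"
        by (rule span_mult_stable[OF _ n], rule int_span.span_base) (use ij in \<open>force simp: S_def mult.commute\<close>)
      ultimately show ?thesis by simp
    qed
    thus ?thesis by (simp add: ij(3) mult_ac)
  qed
  have fin: "finite S" by (simp add: S_def)
  \<comment> \<open>If \<open>m\<close> or \<open>n\<close> were 0, the span of the empty set would
    contain 1.\<close>
  have "m > 0" "n > 0"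
    using m n by (auto intro!: gr0I)
  hence one: "1 \<in> S"
    by (auto simp: S_def intro!: image_eqI[of _ _ "(0, 0)"])
  show "algebraic_int (x + y)"
    by (rule algebraic_int_stable_span[OF fin one])
       (auto simp: distrib_right intro!: int_span.span_add Sx Sy)
  show "algebraic_int (x * y)"
    by (rule algebraic_int_stable_span[OF fin one])
       (auto simp: mult.assoc intro!: span_mult_stable[OF Sx] Sy)
qed

lemma algebraic_int_diff:
  "algebraic_int x \<Longrightarrow> algebraic_int y \<Longrightarrow> algebraic_int (x - y)" for x y :: complex
  using algebraic_int_plus_times(1)[of x "- y"] by simp

lemma algebraic_int_of_power:
  assumes "algebraic_int (x ^ n)" "n > 0"
  shows "algebraic_int x"
proof (rule algebraic_int_root[OF assms(1)])
  show "poly (Polynomial.monom 1 n) x = x ^ n"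
    by (simp add: poly_monom)
qed (use assms(2) in \<open>auto simp: Polynomial.degree_monom_eq\<close>)

text \<open>The monic polynomial \<open>X\<^sup>2 - X\<close> takes an algebraic integer as its
  value at \<open>x\<close>, and algebraic integers are integrally closed.\<close>

lemma algebraic_int_of_mult_pred:
  fixes x :: complex
  assumes "algebraic_int (x * (x - 1))"
  shows "algebraic_int x"
proof (rule algebraic_int_root[OF assms])
  show "poly [:0, -1, 1:] x = x * (x - 1)"
    by (simp add: algebra_simps)
qed (auto simp: Polynomial.coeff_pCons split: nat.splits)

text \<open>A Bezout relation between \<open>m\<close> and \<open>n\<close> writes \<open>x\<close>
  as an integer combination of \<open>m * x\<close> and \<open>n * x\<close>.\<close>

lemma algebraic_int_coprime_cancel:
  fixes x :: complex and m n :: nat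
  assumes "coprime m n" "algebraic_int (of_nat m * x)" "algebraic_int (of_nat n * x)"
  shows "algebraic_int x"
proof -
  obtain u v where "u * int m + v * int n = 1"
    using assms(1) bezout_int[of "int m" "int n"] by (auto simp: coprime_iff_gcd_eq_1)
  hence uv: "(of_int u * of_nat m + of_int v * of_nat n :: complex) = 1"
    by (metis of_int_1 of_int_add of_int_mult of_int_of_nat_eq)
  have "x = (of_int u * of_nat m + of_int v * of_nat n) * x"
    by (simp add: uv)
  also have "\<dots> = of_int u * (of_nat m * x) + of_int v * (of_nat n * x)"
    by (simp add: algebra_simps)
  also have "algebraic_int \<dots>"
    by (intro algebraic_int_plus_times assms algebraic_int_of_int)
  finally show ?thesis .
qed

subsection \<open>Quadratic extensions of subfields of the complex numbers\<close>

abbreviation subfield_of_complex :: "complex set \<Rightarrow> bool" where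
  "subfield_of_complex K \<equiv> subfield K complex_ring"

lemma field_complex_ring: "field complex_ring"
  by (rule field_from_type_algebra)

lemma cring_complex_ring: "cring complex_ring" and ring_complex_ring: "ring complex_ring"
  by auto

lemma complex_ring_simps [simp]:
  "carrier complex_ring = UNIV" "x \<otimes>\<^bsub>complex_ring\<^esub> y = x * y" "x \<oplus>\<^bsub>complex_ring\<^esub> y = x + y"
  "\<one>\<^bsub>complex_ring\<^esub> = 1" "\<zero>\<^bsub>complex_ring\<^esub> = 0"
  by (simp_all add: ring_of_type_algebra_def)

lemma complex_ring_uminus [simp]: "\<ominus>\<^bsub>complex_ring\<^esub> x = - x"
  by (rule abelian_group.minus_equality[OF ring.is_abelian_group[OF ring_complex_ring]]) simp_all

lemma complex_ring_inverse [simp]: "x \<noteq> 0 \<Longrightarrow> inv\<^bsub>complex_ring\<^esub> x = inverse x"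
  by (rule comm_monoid.comm_inv_char[OF cring.axioms(2)[OF cring_complex_ring]]) simp_all

lemma subfield_of_complexI:
  assumes "1 \<in> K" "\<And>x. x \<in> K \<Longrightarrow> - x \<in> K" "\<And>x y. x \<in> K \<Longrightarrow> y \<in> K \<Longrightarrow> x + y \<in> K"
    "\<And>x y. x \<in> K \<Longrightarrow> y \<in> K \<Longrightarrow> x * y \<in> K" "\<And>x. x \<in> K \<Longrightarrow> x \<noteq> 0 \<Longrightarrow> inverse x \<in> K"
  shows "subfield_of_complex K"
proof (rule field.subfieldI'[OF field_complex_ring])
  show "subring K complex_ring"
    by (rule ring.subringI[OF ring_complex_ring]) (use assms in auto)
qed (use assms in auto)

context
  fixes K :: "complex set"
  assumes K: "subfield_of_complex K"
begin

lemma subfield_one: "1 \<in> K"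
  and subfield_zero: "0 \<in> K"
  and subfield_uminus: "x \<in> K \<Longrightarrow> - x \<in> K"
  and subfield_add: "x \<in> K \<Longrightarrow> y \<in> K \<Longrightarrow> x + y \<in> K"
  and subfield_mult: "x \<in> K \<Longrightarrow> y \<in> K \<Longrightarrow> x * y \<in> K"
  using subringE(2,3,5,6,7)[OF subfieldE(1)[OF K]] by simp_all

lemma subfield_inverse: "x \<in> K \<Longrightarrow> inverse x \<in> K"
  using ring.subfield_m_inv(1)[OF ring_complex_ring K, of x] by (cases "x = 0") simp_all

lemma subfield_diff: "x \<in> K \<Longrightarrow> y \<in> K \<Longrightarrow> x - y \<in> K"
  using subfield_add[of x "- y"] subfield_uminus[of y] by simp

lemma subfield_divide: "x \<in> K \<Longrightarrow> y \<in> K \<Longrightarrow> x / y \<in> K"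
  using subfield_mult[of x "inverse y"] subfield_inverse[of y] by (simp add: divide_inverse)

lemma subfield_power: "x \<in> K \<Longrightarrow> x ^ n \<in> K"
  by (induction n) (auto simp: subfield_one subfield_mult)

lemma subfield_prod: "(\<And>i. i \<in> I \<Longrightarrow> f i \<in> K) \<Longrightarrow> prod f I \<in> K"
  by (induction I rule: infinite_finite_induct) (auto simp: subfield_one subfield_mult)

lemma subfield_of_int: "of_int n \<in> K"
proof -
  have "of_nat m \<in> K" for m
    by (induction m) (auto simp: subfield_zero subfield_one subfield_add)
  thus ?thesis by (cases n rule: int_cases2) (auto simp: subfield_uminus)
qed

lemma subfield_of_nat: "of_nat n \<in> K"
  using subfield_of_int[of "int n"] by simp

lemma subfield_numeral: "numeral n \<in> K"
  using subfield_of_nat[of "numeral n"] by simp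

lemmas subfield_closed = subfield_one subfield_zero subfield_uminus subfield_add subfield_mult
  subfield_inverse subfield_diff subfield_divide subfield_power subfield_prod subfield_of_int
  subfield_of_nat subfield_numeral

lemma integers_of_closed:
  shows "x \<in> integers_of K \<Longrightarrow> y \<in> integers_of K \<Longrightarrow> x + y \<in> integers_of K"
    and "x \<in> integers_of K \<Longrightarrow> y \<in> integers_of K \<Longrightarrow> x - y \<in> integers_of K"
    and "x \<in> integers_of K \<Longrightarrow> y \<in> integers_of K \<Longrightarrow> x * y \<in> integers_of K"
    and "x \<in> integers_of K \<Longrightarrow> - x \<in> integers_of K"
    and "0 \<in> integers_of K" and "1 \<in> integers_of K" and "of_int n \<in> integers_of K"
  by (auto simp: integers_of_def algebraic_int_plus_times algebraic_int_diff subfield_closed)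

lemma subfield_quadratic_coeffs:
  assumes "s \<notin> K" "a \<in> K" "b \<in> K" "a + b * s = 0"
  shows "a = 0 \<and> b = 0"
proof -
  have "b = 0"
  proof (rule ccontr)
    assume "b \<noteq> 0"
    hence "s = - a / b" using assms(4) by (simp add: field_simps add_eq_0_iff)
    thus False using assms by (simp add: subfield_closed)
  qed
  thus ?thesis using assms by simp
qed

lemma subfield_quadratic:
  assumes s2: "s\<^sup>2 \<in> K"
  shows "subfield_of_complex {a + b * s | a b. a \<in> K \<and> b \<in> K}"
proof (cases "s \<in> K")
  case True
  have "x \<in> {a + b * s | a b. a \<in> K \<and> b \<in> K}" if "x \<in> K" for x
    using that by (intro CollectI exI[of _ x] exI[of _ 0]) (auto simp: subfield_closed)
  hence "{a + b * s | a b. a \<in> K \<and> b \<in> K} = K"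
    using True by (auto intro: subfield_closed)
  thus ?thesis using K by simp
next
  case False
  have I: "x \<in> {a + b * s | a b. a \<in> K \<and> b \<in> K}" if "x = a + b * s" "a \<in> K" "b \<in> K" for x a b
    using that by blast
  show ?thesis
  proof (rule subfield_of_complexI)
    show "1 \<in> {a + b * s | a b. a \<in> K \<and> b \<in> K}"
      by (rule I[of _ 1 0]) (auto simp: subfield_closed)
    fix x assume "x \<in> {a + b * s | a b. a \<in> K \<and> b \<in> K}"
    then obtain a b where x: "x = a + b * s" "a \<in> K" "b \<in> K" by blast
    show "- x \<in> {a + b * s | a b. a \<in> K \<and> b \<in> K}"
      by (rule I[of _ "- a" "- b"]) (auto simp: x subfield_closed)
    {
      assume "x \<noteq> 0"
      \<comment> \<open>\<open>d\<close> is the norm of \<open>x\<close> over \<open>K\<close>. The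
        conjugate \<open>a - b * s\<close> is nonzero, since otherwise both coordinates of
        \<open>x\<close> would vanish.\<close>
      define d where "d = a\<^sup>2 - b\<^sup>2 * s\<^sup>2"
      have d: "d = (a + b * s) * (a - b * s)"
        by (simp add: d_def power2_eq_square algebra_simps)
      have "a - b * s \<noteq> 0"
        using subfield_quadratic_coeffs[of s a "- b"] False x \<open>x \<noteq> 0\<close> by (auto simp: subfield_closed)
      hence "d \<noteq> 0" using d x \<open>x \<noteq> 0\<close> by simp
      have "inverse x = (a - b * s) / d"
        using \<open>d \<noteq> 0\<close> by (simp add: d x divide_simps)
      hence "inverse x = a / d + (- b / d) * s"
        by (simp add: diff_divide_distrib)
      moreover have "d \<in> K"
        using x s2 by (simp add: d_def subfield_closed)
      ultimately show "inverse x \<in> {a + b * s | a b. a \<in> K \<and> b \<in> K}"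
        using x by (intro I[of _ "a / d" "- b / d"]) (simp_all add: subfield_closed)
    }
    fix y assume "y \<in> {a + b * s | a b. a \<in> K \<and> b \<in> K}"
    then obtain c d where y: "y = c + d * s" "c \<in> K" "d \<in> K" by blast
    show "x + y \<in> {a + b * s | a b. a \<in> K \<and> b \<in> K}"
      by (rule I[of _ "a + c" "b + d"]) (auto simp: x y subfield_closed algebra_simps)
    show "x * y \<in> {a + b * s | a b. a \<in> K \<and> b \<in> K}"
      by (rule I[of _ "a * c + b * d * s\<^sup>2" "a * d + b * c"])
         (use x y s2 in \<open>simp_all add: subfield_closed\<close>, simp add: algebra_simps power2_eq_square)
  qed
qed

text \<open>An integer polynomial takes conjugate values at conjugate arguments, so a monic one that
  kills \<open>a + b * s\<close> also kills \<open>a - b * s\<close>. This avoids constructing the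
  field automorphism.\<close>

lemma algebraic_int_conjugate:
  assumes s: "s\<^sup>2 \<in> K" "s \<notin> K" and ab: "a \<in> K" "b \<in> K" and int: "algebraic_int (a + b * s)"
  shows "algebraic_int (a - b * s)"
proof -
  have ev: "\<exists>u\<in>K. \<exists>v\<in>K. poly (map_poly of_int q) (a + b * s) = u + v * s \<and>
      poly (map_poly of_int q) (a - b * s) = u - v * s" for q
  proof (induction q)
    case 0
    show ?case by (intro bexI[of _ 0]) (auto simp: subfield_closed)
  next
    case (pCons c q)
    then obtain u v where uv: "u \<in> K" "v \<in> K"
      "poly (map_poly of_int q) (a + b * s) = u + v * s"
      "poly (map_poly of_int q) (a - b * s) = u - v * s" by blast
    have step: "poly (map_poly of_int (pCons c q)) z = of_int c + z * poly (map_poly of_int q) z"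
      for z :: complex by (simp add: of_int_hom.map_poly_pCons_hom)
    show ?case
    \<comment> \<open>The witnesses are the coordinates of
      \<open>c + (a + b * s) * (u + v * s)\<close>, one step of Horner's rule.\<close>
    proof (rule bexI[of _ "of_int c + a * u + b * v * s\<^sup>2"], rule bexI[of _ "a * v + b * u"])
      show "of_int c + a * u + b * v * s\<^sup>2 \<in> K" "a * v + b * u \<in> K"
        using uv(1,2) ab s(1) by (simp_all add: subfield_closed)
    qed (simp add: step uv(3,4) algebra_simps power2_eq_square)
  qed
  obtain q where q: "poly (map_poly of_int q) (a + b * s) = 0" "lead_coeff q = 1"
    using int by (auto simp: algebraic_int_altdef_ipoly)
  obtain u v where uv: "u \<in> K" "v \<in> K" "poly (map_poly of_int q) (a + b * s) = u + v * s"
      "poly (map_poly of_int q) (a - b * s) = u - v * s"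
    using ev[of q] by blast
  have "u = 0 \<and> v = 0"
    using subfield_quadratic_coeffs[OF s(2) uv(1,2)] uv(3) q(1) by simp
  hence "poly (map_poly of_int q) (a - b * s) = 0" using uv by simp
  thus ?thesis using q(2) by (auto simp: algebraic_int_altdef_ipoly)
qed

end

section \<open>Adjoining elements to a subfield, and integers of a quadratic extension\<close>

lemma subfield_adjoin: "subfield_of_complex (adjoin K A)"
  unfolding adjoin_def by (rule field.generate_field_is_subfield[OF field_complex_ring]) simp

lemma adjoin_incl: "K \<union> A \<subseteq> adjoin K A"
  unfolding adjoin_def by (auto intro: generate_field.incl)

lemma adjoin_minimal: "subfield_of_complex E \<Longrightarrow> K \<union> A \<subseteq> E \<Longrightarrow> adjoin K A \<subseteq> E"
  unfolding adjoin_def by (rule field.generate_field_min_subfield1[OF field_complex_ring]) auto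

lemma adjoin_mono: "A \<subseteq> B \<Longrightarrow> adjoin K A \<subseteq> adjoin K B"
  using adjoin_incl[of K B] by (intro adjoin_minimal subfield_adjoin) auto

lemma adjoin_empty: "subfield_of_complex K \<Longrightarrow> adjoin K {} = K"
  using adjoin_incl[of K "{}"] adjoin_minimal[of K K "{}"] by auto

lemma adjoin_insert: "adjoin K (insert s A) = adjoin (adjoin K A) {s}"
proof
  show "adjoin K (insert s A) \<subseteq> adjoin (adjoin K A) {s}"
    using adjoin_incl[of K A] adjoin_incl[of "adjoin K A" "{s}"]
    by (intro adjoin_minimal subfield_adjoin) auto
  show "adjoin (adjoin K A) {s} \<subseteq> adjoin K (insert s A)"
    using adjoin_mono[of A "insert s A" K] adjoin_incl[of K "insert s A"]
    by (intro adjoin_minimal subfield_adjoin) auto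
qed

lemma adjoin_quadratic:
  assumes K: "subfield_of_complex K" and s2: "s\<^sup>2 \<in> K"
  shows "adjoin K {s} = {a + b * s | a b. a \<in> K \<and> b \<in> K}"
proof
  have "a = a + 0 * s" "s = 0 + 1 * s" for a by auto
  hence "K \<union> {s} \<subseteq> {a + b * s | a b. a \<in> K \<and> b \<in> K}"
    using subfield_zero[OF K] subfield_one[OF K] by blast
  thus "adjoin K {s} \<subseteq> {a + b * s | a b. a \<in> K \<and> b \<in> K}"
    by (intro adjoin_minimal subfield_quadratic[OF K s2])
  show "{a + b * s | a b. a \<in> K \<and> b \<in> K} \<subseteq> adjoin K {s}"
    using adjoin_incl[of K "{s}"] subfield_adjoin[of K "{s}"]
    by (auto intro!: subfield_add subfield_mult)
qed

lemma adjoin_insert_quadratic: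
  assumes "s\<^sup>2 \<in> K"
  shows "adjoin K (insert s A) = {a + b * s | a b. a \<in> adjoin K A \<and> b \<in> adjoin K A}"
  using assms adjoin_incl[of K A]
  by (subst adjoin_insert, intro adjoin_quadratic subfield_adjoin) auto

lemma adjoin_absorb:
  assumes "s \<in> adjoin K A"
  shows "adjoin K (insert s A) = adjoin K A"
  using assms adjoin_incl[of K A] adjoin_mono[of A "insert s A" K]
    adjoin_minimal[OF subfield_adjoin, of K "insert s A" K A] by auto

lemma subfield_Rats: "subfield_of_complex \<rat>"
  by (rule subfield_of_complexI) auto

lemma integers_of_Rats: "integers_of \<rat> = \<int>"
  by (auto simp: integers_of_def int_imp_algebraic_int rational_algebraic_int_is_int
      elim: Ints_cases)

text \<open>The hypothesis \<open>cancel\<close> isolates the arithmetic input: no denominator of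
  \<open>b\<close> may be absorbed by \<open>s\<close>. It comes from non-ramification when
  \<open>s\<^sup>2\<close> is a rational prime and from invertibility when \<open>s\<^sup>2\<close>
  is a unit.\<close>

lemma integers_of_quadratic:
  fixes s :: complex
  defines "\<theta> \<equiv> (1 + s) / 2"
  assumes K: "subfield_of_complex K" and s: "s\<^sup>2 \<in> K" "s \<notin> K"
    and \<theta>: "algebraic_int \<theta>"
    and cancel: "\<And>b. b \<in> K \<Longrightarrow> algebraic_int (b\<^sup>2 * s\<^sup>2) \<Longrightarrow> algebraic_int b"
  shows "integers_of (adjoin K {s}) = {a + b * \<theta> | a b. a \<in> integers_of K \<and> b \<in> integers_of K}"
proof (intro equalityI subsetI)
  fix x assume "x \<in> integers_of (adjoin K {s})"
  then obtain u v where uv: "u \<in> K" "v \<in> K" "x = u + v * s" and x: "algebraic_int x"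
    by (auto simp: integers_of_def adjoin_quadratic[OF K s(1)])
  \<comment> \<open>Change of coordinates from \<open>1, s\<close> to \<open>1, \<theta>\<close>,
    using \<open>s = 2 * \<theta> - 1\<close>.\<close>
  define b where "b = 2 * v"
  define a where "a = u - v"
  have ab: "a \<in> K" "b \<in> K"
    using uv by (simp_all add: a_def b_def subfield_closed[OF K])
  have x_eq: "x = a + b * \<theta>"
    by (simp add: uv(3) \<theta>_def a_def b_def distrib_left)
  have "algebraic_int ((u + v * s) - (u - v * s))" (is "algebraic_int ?d")
    using x algebraic_int_conjugate[OF K s uv(1,2)] uv by (intro algebraic_int_diff[of "u + v * s" "u - v * s"]) simp_all
  moreover have "?d = b * s" by (simp add: b_def)
  ultimately have "algebraic_int (b * s)" by (simp only:)
  hence "algebraic_int (b\<^sup>2 * s\<^sup>2)"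
    using algebraic_int_plus_times(2)[of "b * s" "b * s"] by (simp add: power2_eq_square mult_ac)
  hence b: "algebraic_int b" by (rule cancel[OF ab(2)])
  have "algebraic_int (x - b * \<theta>)"
    by (intro algebraic_int_diff algebraic_int_plus_times x b \<theta>)
  hence "algebraic_int a" by (simp add: x_eq)
  thus "x \<in> {a + b * \<theta> | a b. a \<in> integers_of K \<and> b \<in> integers_of K}"
    using x_eq ab b by (auto simp: integers_of_def)
next
  fix x assume "x \<in> {a + b * \<theta> | a b. a \<in> integers_of K \<and> b \<in> integers_of K}"
  then obtain a b where ab: "x = a + b * \<theta>" "a \<in> integers_of K" "b \<in> integers_of K" by blast
  have "s \<in> adjoin K {s}" "a \<in> adjoin K {s}" "b \<in> adjoin K {s}"
    using ab adjoin_incl[of K "{s}"] by (auto simp: integers_of_def)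
  hence "x \<in> adjoin K {s}"
    unfolding ab(1) \<theta>_def
    by (intro subfield_add[OF subfield_adjoin] subfield_mult[OF subfield_adjoin]
        subfield_divide[OF subfield_adjoin] subfield_one[OF subfield_adjoin]
        subfield_numeral[OF subfield_adjoin])
  moreover have "algebraic_int x"
    using ab \<theta> by (simp add: integers_of_def algebraic_int_plus_times)
  ultimately show "x \<in> integers_of (adjoin K {s})"
    by (simp add: integers_of_def)
qed

lemma integers_of_quadratic_unique:
  assumes K: "subfield_of_complex K" and s: "s \<notin> K" and ab: "a \<in> K" "b \<in> K"
    and eq: "a + b * ((1 + s) / 2) = 0"
  shows "a = 0 \<and> b = 0"
proof -
  have "(a + b / 2) + (b / 2) * s = a + b * ((1 + s) / 2)"
    by (simp add: distrib_left add_divide_distrib)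
  also have "\<dots> = 0" by (rule eq)
  finally have "(a + b / 2) + (b / 2) * s = 0" .
  hence "a + b / 2 = 0 \<and> b / 2 = 0"
    using ab by (intro subfield_quadratic_coeffs[OF K s]) (simp_all add: subfield_closed[OF K])
  thus ?thesis by auto
qed

subsection \<open>Integral bases of towers\<close>

lemma sum_Pow_insert:
  assumes "finite T" "t \<notin> T"
  shows "sum f (Pow (insert t T)) = sum f (Pow T) + (\<Sum>U\<in>Pow T. f (insert t U))"
proof -
  have "inj_on (insert t) (Pow T)"
    using assms(2) by (auto simp: inj_on_def)
  thus ?thesis
    using assms unfolding Pow_insert
    by (subst sum.union_disjoint) (auto simp: sum.reindex)
qed

lemma sum_in_closed_set:
  assumes "0 \<in> M" "\<And>x y. x \<in> M \<Longrightarrow> y \<in> M \<Longrightarrow> x + y \<in> M" "\<And>i. i \<in> I \<Longrightarrow> f i \<in> M"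
  shows "sum f I \<in> M"
  using assms(3) by (induction I rule: infinite_finite_induct) (auto intro: assms(1,2))

text \<open>Subsets of \<open>insert t T\<close> that avoid \<open>t\<close> contribute an element
  of \<open>M\<close>, those that contain \<open>t\<close> an element of \<open>M\<close> times
  \<open>\<theta> t\<close>. As \<open>M'\<close> is the direct sum of these two pieces, existence
  and uniqueness of coordinates both reduce to \<open>M\<close>.\<close>

lemma basis_family_insert:
  fixes \<theta> :: "'i \<Rightarrow> 'a :: comm_ring_1"
  assumes basis: "basis_family R M (Pow T) (\<lambda>U. \<Prod>i\<in>U. \<theta> i)"
    and T: "finite T" "t \<notin> T"
    and M: "0 \<in> M" "\<And>x y. x \<in> M \<Longrightarrow> y \<in> M \<Longrightarrow> x + y \<in> M" "\<And>r x. r \<in> R \<Longrightarrow> x \<in> M \<Longrightarrow> r * x \<in> M"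
    and M': "M' = {a + b * \<theta> t | a b. a \<in> M \<and> b \<in> M}"
    and uniq: "\<And>a b. a \<in> M \<Longrightarrow> b \<in> M \<Longrightarrow> a + b * \<theta> t = 0 \<Longrightarrow> a = 0 \<and> b = 0"
  shows "basis_family R M' (Pow (insert t T)) (\<lambda>U. \<Prod>i\<in>U. \<theta> i)"
proof -
  let ?b = "\<lambda>U. \<Prod>i\<in>U. \<theta> i"
  have b_insert: "?b (insert t U) = \<theta> t * ?b U" if "U \<in> Pow T" for U
    using that T by (subst prod.insert) (auto intro: finite_subset)
  have split: "(\<Sum>U\<in>Pow (insert t T). c U * ?b U) =
      (\<Sum>U\<in>Pow T. c U * ?b U) + (\<Sum>U\<in>Pow T. c (insert t U) * ?b U) * \<theta> t" for c
    unfolding sum_Pow_insert[OF T] sum_distrib_right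
    by (intro arg_cong2[of _ _ _ _ "(+)"] sum.cong refl) (simp add: b_insert mult_ac)
  have bM: "?b U \<in> M" if "U \<in> Pow T" for U
    using basis that unfolding basis_family_def by blast
  have span: "\<exists>c\<in>Pow T \<rightarrow> R. x = (\<Sum>U\<in>Pow T. c U * ?b U)" if "x \<in> M" for x
    using basis that by (simp add: basis_family_def)
  have indep: "\<forall>U\<in>Pow T. c U = 0" if "c \<in> Pow T \<rightarrow> R" "(\<Sum>U\<in>Pow T. c U * ?b U) = 0" for c
    using basis that by (simp add: basis_family_def)
  have sumM: "(\<Sum>U\<in>Pow T. c U * ?b U) \<in> M" if "c \<in> Pow T \<rightarrow> R" for c
    by (rule sum_in_closed_set[OF M(1,2)]) (use that bM M(3) in \<open>auto simp: Pi_iff\<close>)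
  show ?thesis
    unfolding basis_family_def
  proof (intro conjI ballI impI)
    show "finite (Pow (insert t T))"
      using T by simp
    have "?b U \<in> M'" "?b (insert t U) \<in> M'" if "U \<in> Pow T" for U
    proof -
      have "?b U = ?b U + 0 * \<theta> t" "?b (insert t U) = 0 + ?b U * \<theta> t"
        by (simp_all add: b_insert[OF that] mult.commute)
      thus "?b U \<in> M'" "?b (insert t U) \<in> M'"
        unfolding M' using bM[OF that] M(1) by blast+
    qed
    thus "?b ` Pow (insert t T) \<subseteq> M'"
      unfolding Pow_insert by blast
  next
    fix x assume "x \<in> M'"
    then obtain a b where ab: "x = a + b * \<theta> t" "a \<in> M" "b \<in> M"
      unfolding M' by blast
    obtain c where c: "c \<in> Pow T \<rightarrow> R" "a = (\<Sum>U\<in>Pow T. c U * ?b U)"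
      using span[OF ab(2)] by (elim bexE)
    obtain d where d: "d \<in> Pow T \<rightarrow> R" "b = (\<Sum>U\<in>Pow T. d U * ?b U)"
      using span[OF ab(3)] by (elim bexE)
    \<comment> \<open>The coordinates of \<open>a\<close> are placed on the subsets without
      \<open>t\<close>, those of \<open>b\<close> on the subsets with \<open>t\<close>.\<close>
    define e where "e = (\<lambda>U. if t \<in> U then d (U - {t}) else c U)"
    have e1: "e U = c U" and e2: "e (insert t U) = d U" if "U \<in> Pow T" for U
    proof -
      have "t \<notin> U" using that T(2) by auto
      thus "e U = c U" "e (insert t U) = d U" by (simp_all add: e_def)
    qed
    have "e \<in> Pow (insert t T) \<rightarrow> R"
      using c(1) d(1) T(2) by (auto simp: e_def Pi_iff)
    moreover have "x = (\<Sum>U\<in>Pow (insert t T). e U * ?b U)"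
      unfolding split ab(1) c(2) d(2) by (simp add: e1 e2)
    ultimately show "\<exists>c\<in>Pow (insert t T) \<rightarrow> R. x = (\<Sum>U\<in>Pow (insert t T). c U * ?b U)"
      by blast
  next
    fix c U
    assume c: "c \<in> Pow (insert t T) \<rightarrow> R" and 0: "(\<Sum>U\<in>Pow (insert t T). c U * ?b U) = 0"
      and U: "U \<in> Pow (insert t T)"
    have c1: "c \<in> Pow T \<rightarrow> R" and c2: "(\<lambda>U. c (insert t U)) \<in> Pow T \<rightarrow> R"
      using c by (auto simp: Pi_iff)
    have "(\<Sum>U\<in>Pow T. c U * ?b U) = 0 \<and> (\<Sum>U\<in>Pow T. c (insert t U) * ?b U) = 0"
      using uniq[OF sumM[OF c1] sumM[OF c2]] 0 by (simp only: split)
    hence "\<forall>U\<in>Pow T. c U = 0" "\<forall>U\<in>Pow T. c (insert t U) = 0"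
      using indep[OF c1] indep[OF c2] by simp_all
    thus "c U = 0"
      using U unfolding Pow_insert by blast
  qed
qed

text \<open>The tower law: expand over \<open>M\<close> first, then expand each coefficient over
  \<open>R\<close>. Vanishing of coefficients follows in the same order.\<close>

lemma basis_family_trans:
  assumes b: "basis_family R M I b" and d: "basis_family M M' J d"
    and M: "0 \<in> M" "\<And>x y. x \<in> M \<Longrightarrow> y \<in> M \<Longrightarrow> x + y \<in> M" "\<And>r x. r \<in> R \<Longrightarrow> x \<in> M \<Longrightarrow> r * x \<in> M"
    and M': "\<And>m x. m \<in> M \<Longrightarrow> x \<in> M' \<Longrightarrow> m * x \<in> M'"
  shows "basis_family R M' (J \<times> I) (\<lambda>(j, i). d j * b i)"
proof -
  have fin: "finite I" "finite J" and bM: "b ` I \<subseteq> M" and dM: "d ` J \<subseteq> M'"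
    using b d by (auto simp: basis_family_def)
  have split: "(\<Sum>k\<in>J \<times> I. c k * (case k of (j, i) \<Rightarrow> d j * b i)) =
      (\<Sum>j\<in>J. (\<Sum>i\<in>I. c (j, i) * b i) * d j)" for c
    by (simp add: sum.cartesian_product sum_distrib_right sum_distrib_left mult_ac split_beta)
  have sumM: "(\<Sum>i\<in>I. c i * b i) \<in> M" if "c \<in> I \<rightarrow> R" for c
    by (rule sum_in_closed_set[OF M(1,2)]) (use that bM M(3) in \<open>auto simp: Pi_iff\<close>)
  show ?thesis
    unfolding basis_family_def
  proof (intro conjI ballI impI)
    show "finite (J \<times> I)" using fin by simp
    show "(\<lambda>(j, i). d j * b i) ` (J \<times> I) \<subseteq> M'"
      using bM dM M' by (auto simp: mult.commute[of "d _"])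
  next
    fix x assume "x \<in> M'"
    hence "\<exists>c\<in>J \<rightarrow> M. x = (\<Sum>j\<in>J. c j * d j)"
      using d by (simp add: basis_family_def)
    then obtain c where c: "c \<in> J \<rightarrow> M" "x = (\<Sum>j\<in>J. c j * d j)"
      by (elim bexE)
    have "\<forall>j\<in>J. \<exists>e. e \<in> I \<rightarrow> R \<and> c j = (\<Sum>i\<in>I. e i * b i)"
      using c(1) b unfolding basis_family_def by blast
    then obtain e where e: "\<forall>j\<in>J. e j \<in> I \<rightarrow> R \<and> c j = (\<Sum>i\<in>I. e j i * b i)"
      by metis
    show "\<exists>c\<in>J \<times> I \<rightarrow> R. x = (\<Sum>k\<in>J \<times> I. c k * (case k of (j, i) \<Rightarrow> d j * b i))"
    proof
      show "(\<lambda>(j, i). e j i) \<in> J \<times> I \<rightarrow> R" using e by auto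
      show "x = (\<Sum>k\<in>J \<times> I. (case k of (j, i) \<Rightarrow> e j i) * (case k of (j, i) \<Rightarrow> d j * b i))"
        unfolding split c(2) using e by simp
    qed
  next
    fix c k
    assume c: "c \<in> J \<times> I \<rightarrow> R" and k: "k \<in> J \<times> I"
      and 0: "(\<Sum>k\<in>J \<times> I. c k * (case k of (j, i) \<Rightarrow> d j * b i)) = 0"
    have c': "(\<lambda>i. c (j, i)) \<in> I \<rightarrow> R" if "j \<in> J" for j
      using c that by auto
    define e where "e = (\<lambda>j. \<Sum>i\<in>I. c (j, i) * b i)"
    have "e \<in> J \<rightarrow> M"
      unfolding e_def by (rule Pi_I) (rule sumM[OF c'])
    moreover have "(\<Sum>j\<in>J. e j * d j) = 0"
      using 0 unfolding split e_def .
    moreover have "\<forall>c\<in>J \<rightarrow> M. (\<Sum>j\<in>J. c j * d j) = 0 \<longrightarrow> (\<forall>j\<in>J. c j = 0)"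
      using d by (simp add: basis_family_def)
    ultimately have "\<forall>j\<in>J. e j = 0" by blast
    hence "\<forall>j\<in>J. (\<Sum>i\<in>I. c (j, i) * b i) = 0" by (simp only: e_def)
    moreover have "\<forall>i\<in>I. f i = 0" if "f \<in> I \<rightarrow> R" "(\<Sum>i\<in>I. f i * b i) = 0" for f
      using b that by (simp add: basis_family_def)
    from this[OF c'] have "\<forall>i\<in>I. c (j, i) = 0" if "j \<in> J" "(\<Sum>i\<in>I. c (j, i) * b i) = 0" for j
      using that by simp
    ultimately have "\<forall>j\<in>J. \<forall>i\<in>I. c (j, i) = 0" by simp
    thus "c k = 0" using k by auto
  qed
qed

text \<open>One statement serves both layers of the tower, with \<open>F\<close> the rationals or
  \<open>L\<close>. The last two hypotheses range over all \<open>U\<close> and all \<open>t\<close>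
  outside \<open>U\<close>, so the roots may be adjoined in whatever order the induction picks
  them.\<close>

lemma multiquadratic_integral_basis:
  assumes F: "subfield_of_complex F" and T: "finite T"
    and sq: "\<And>t. t \<in> T \<Longrightarrow> (s t)\<^sup>2 \<in> F"
    and int: "\<And>t. t \<in> T \<Longrightarrow> algebraic_int ((1 + s t) / 2)"
    and indep: "\<And>U t. U \<subseteq> T \<Longrightarrow> t \<in> T - U \<Longrightarrow> s t \<notin> adjoin F (s ` U)"
    and cancel: "\<And>U t b. U \<subseteq> T \<Longrightarrow> t \<in> T - U \<Longrightarrow> b \<in> adjoin F (s ` U) \<Longrightarrow>
      algebraic_int (b\<^sup>2 * (s t)\<^sup>2) \<Longrightarrow> algebraic_int b"
  shows "basis_family (integers_of F) (integers_of (adjoin F (s ` T))) (Pow T)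
    (\<lambda>U. \<Prod>t\<in>U. (1 + s t) / 2)"
  using T subset_refl
proof (induction rule: finite_subset_induct')
  case empty
  \<comment> \<open>The only index is the empty set, with product 1, and the coordinate of an
    element is the element itself.\<close>
  show ?case
    using integers_of_closed(6)[OF F]
    by (auto simp: basis_family_def adjoin_empty[OF F] Pi_iff intro!: bexI[of _ "\<lambda>_. _"])
next
  case (insert t U)
  let ?K = "adjoin F (s ` U)"
  have K: "subfield_of_complex ?K" by (rule subfield_adjoin)
  have st: "(s t)\<^sup>2 \<in> ?K" using sq insert adjoin_incl[of F "s ` U"] by auto
  have nt: "s t \<notin> ?K" using indep insert by auto
  have *: "integers_of (adjoin F (s ` insert t U)) =
      {a + b * ((1 + s t) / 2) | a b. a \<in> integers_of ?K \<and> b \<in> integers_of ?K}"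
    unfolding image_insert adjoin_insert[of F "s t" "s ` U"]
    by (rule integers_of_quadratic[OF K st nt])
       (use int cancel[of U t] insert in auto)
  show ?case
  proof (rule basis_family_insert[OF insert.IH _ _ _ _ _ *])
    show "a = 0 \<and> b = 0"
      if "a \<in> integers_of ?K" "b \<in> integers_of ?K" "a + b * ((1 + s t) / 2) = 0" for a b
      by (rule integers_of_quadratic_unique[OF K nt]) (use that in \<open>simp_all add: integers_of_def\<close>)
    show "r * x \<in> integers_of ?K" if "r \<in> integers_of F" "x \<in> integers_of ?K" for r x
      using that adjoin_incl[of F "s ` U"]
      by (intro integers_of_closed(3)[OF K]) (auto simp: integers_of_def)
  qed (use insert T integers_of_closed[OF K] in \<open>auto intro: finite_subset\<close>)
qed

section \<open>Ramification and Kummer theory for multiquadratic fields\<close>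

text \<open>
  This is the statement that \<open>O/pO\<close> is reduced for the ring of integers \<open>O\<close> of the multiquadratic
  field, that is, that \<open>p\<close> does not ramify.  In the inductive step, traces and norms of an element
  \<open>b\<close> and its conjugate \<open>b'\<close> show that \<open>b + b'\<close> and \<open>b - b'\<close> are integral.
\<close>

lemma unramified_prime_cancel:
  fixes s :: "'i \<Rightarrow> complex" and r :: "'i \<Rightarrow> nat"
  assumes p: "Factorial_Ring.prime p" "odd p" and U: "finite U"
    and r: "\<And>i. i \<in> U \<Longrightarrow> (s i)\<^sup>2 = of_nat (r i) \<and> coprime (r i) p"
    and b: "b \<in> adjoin \<rat> (s ` U)" "algebraic_int (of_nat p * b\<^sup>2)"
  shows "algebraic_int b"
proof -
  \<comment> \<open>Thus \<open>p\<close> clears every denominator in question. The inductive step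
    looks for a second multiplier, coprime to \<open>p\<close>, with the same effect.\<close>
  have p_mult: "algebraic_int (of_nat p * x)" if "algebraic_int (of_nat p * x\<^sup>2)" for x :: complex
  proof (rule algebraic_int_of_power)
    have "algebraic_int (of_nat p * (of_nat p * x\<^sup>2))"
      by (rule algebraic_int_plus_times(2)[OF _ that]) simp
    thus "algebraic_int ((of_nat p * x)\<^sup>2)"
      by (simp add: power2_eq_square mult_ac)
  qed simp
  show ?thesis
    using U r b
  proof (induction U arbitrary: b rule: finite_induct)
    case empty
    have b: "b \<in> \<rat>" using empty(2) by (simp add: adjoin_empty[OF subfield_Rats])
    have "of_nat p * b\<^sup>2 \<in> \<int>" "of_nat p * b \<in> \<int>"
      using empty(3) p_mult[OF empty(3)] b
      by (auto intro!: rational_algebraic_int_is_int)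
    \<comment> \<open>For rational \<open>b\<close>, the integer \<open>m = p * b\<close> has
      \<open>m\<^sup>2 = p * k\<close>, so \<open>p\<close> divides \<open>m\<close> and
      \<open>b = m / p\<close> is an integer.\<close>
    then obtain k m where k: "of_nat p * b\<^sup>2 = of_int k" and m: "of_nat p * b = of_int m"
      by (auto elim!: Ints_cases)
    have "of_int (m\<^sup>2) = (of_nat p * b)\<^sup>2" by (simp add: m)
    also have "\<dots> = of_nat p * (of_nat p * b\<^sup>2)" by (simp add: power2_eq_square)
    also have "\<dots> = of_int (int p * k)" by (simp add: k)
    finally have "m\<^sup>2 = int p * k" using of_int_eq_iff by blast
    hence "int p dvd m\<^sup>2" by simp
    hence "int p dvd m" using p(1) prime_dvd_power by (metis prime_nat_int_transfer)
    then obtain n where "m = int p * n" by (auto elim: dvdE)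
    hence "of_nat p * b = of_nat p * of_int n" using m by simp
    hence "b = of_int n" using p(1) by (auto simp: prime_gt_0_nat)
    thus ?case by simp
  next
    case (insert i U)
    let ?K = "adjoin \<rat> (s ` U)" and ?\<sigma> = "s i"
    have K: "subfield_of_complex ?K" by (rule subfield_adjoin)
    have \<sigma>: "?\<sigma>\<^sup>2 = of_nat (r i)" and cop: "coprime (r i) p" using insert.prems(1)[of i] by auto
    have IH: "algebraic_int c" if "c \<in> ?K" "algebraic_int (of_nat p * c\<^sup>2)" for c
      using insert.IH[of c] that insert.prems(1) by auto
    show ?case
    proof (cases "?\<sigma> \<in> ?K")
      case True
      thus ?thesis using insert.prems(2,3) IH adjoin_absorb[of ?\<sigma>] by auto
    next
      case False
      have \<sigma>K: "?\<sigma>\<^sup>2 \<in> ?K" by (simp add: \<sigma> subfield_of_nat[OF K])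
      obtain u v where uv: "u \<in> ?K" "v \<in> ?K" and b_eq: "b = u + v * ?\<sigma>"
        using insert.prems(2) adjoin_insert_quadratic[of ?\<sigma> \<rat> "s ` U"] by (auto simp: \<sigma>)
      define b' where "b' = u - v * ?\<sigma>"
      have pb: "algebraic_int (of_nat p * b\<^sup>2)" by (rule insert.prems(3))
      \<comment> \<open>\<open>A\<close> and \<open>B\<close> are the coordinates of
        \<open>p * b\<^sup>2\<close> over \<open>?K\<close>; conjugating them carries integrality
        over to \<open>p * b'\<^sup>2\<close>.\<close>
      define A where "A = of_nat p * (u\<^sup>2 + v\<^sup>2 * of_nat (r i))"
      define B where "B = of_nat p * 2 * u * v"
      have AB: "A \<in> ?K" "B \<in> ?K"
        unfolding A_def B_def using uv by (simp_all add: subfield_closed[OF K])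
      have "of_nat p * b\<^sup>2 = A + B * ?\<sigma>" "of_nat p * b'\<^sup>2 = A - B * ?\<sigma>"
        by (simp_all add: b_eq b'_def A_def B_def \<sigma>[symmetric] power2_eq_square algebra_simps)
      hence pb': "algebraic_int (of_nat p * b'\<^sup>2)"
        using algebraic_int_conjugate[OF K \<sigma>K False AB] pb by simp
      have "algebraic_int ((of_nat p * b\<^sup>2) * (of_nat p * b'\<^sup>2))"
        by (rule algebraic_int_plus_times(2)[OF pb pb'])
      also have "(of_nat p * b\<^sup>2) * (of_nat p * b'\<^sup>2) = (of_nat p * b * b')\<^sup>2"
        by (simp add: power2_eq_square)
      finally have pbb': "algebraic_int (of_nat p * b * b')"
        by (rule algebraic_int_of_power) simp
      have 2: "algebraic_int (2 * (of_nat p * b * b'))"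
        by (rule algebraic_int_plus_times(2)[OF _ pbb']) simp
      have "algebraic_int (of_nat p * b\<^sup>2 + of_nat p * b'\<^sup>2 + 2 * (of_nat p * b * b'))"
        by (intro algebraic_int_plus_times(1) pb pb' 2)
      also have "of_nat p * b\<^sup>2 + of_nat p * b'\<^sup>2 + 2 * (of_nat p * b * b') = of_nat p * (2 * u)\<^sup>2"
        by (simp add: b_eq b'_def power2_eq_square algebra_simps)
      finally have "algebraic_int (of_nat p * (2 * u)\<^sup>2)" .
      from IH[OF _ this] have u2: "algebraic_int (2 * u)"
        using uv(1) by (simp add: subfield_closed[OF K])
      define w where "w = 2 * v"
      have "algebraic_int (of_nat p * b\<^sup>2 + of_nat p * b'\<^sup>2 - 2 * (of_nat p * b * b'))"
        by (intro algebraic_int_diff algebraic_int_plus_times(1) pb pb' 2)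
      also have "of_nat p * b\<^sup>2 + of_nat p * b'\<^sup>2 - 2 * (of_nat p * b * b') = of_nat p * (w * ?\<sigma>)\<^sup>2"
        by (simp add: b_eq b'_def w_def power2_eq_square algebra_simps)
      finally have pw: "algebraic_int (of_nat p * (w * ?\<sigma>)\<^sup>2)" .
      \<comment> \<open>The induction hypothesis speaks only of elements of \<open>?K\<close>. The
        factor \<open>r i\<close>, which is the square of \<open>?\<sigma>\<close>, replaces
        \<open>w * ?\<sigma>\<close> by the element \<open>r i * w\<close> of
        \<open>?K\<close>.\<close>
      have "algebraic_int (of_nat (r i) * (of_nat p * (w * ?\<sigma>)\<^sup>2))"
        by (rule algebraic_int_plus_times(2)[OF _ pw]) simp
      also have "of_nat (r i) * (of_nat p * (w * ?\<sigma>)\<^sup>2) = of_nat p * (of_nat (r i) * w)\<^sup>2"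
        by (simp add: power_mult_distrib \<sigma>) (simp add: power2_eq_square)
      finally have "algebraic_int (of_nat p * (of_nat (r i) * w)\<^sup>2)" .
      from IH[OF _ this] have "algebraic_int (of_nat (r i) * w)"
        using uv(2) by (simp add: w_def subfield_closed[OF K])
      moreover have "algebraic_int ?\<sigma>"
        by (rule algebraic_int_of_power[of _ 2]) (simp_all add: \<sigma>)
      ultimately have "algebraic_int (of_nat (r i) * (w * ?\<sigma>))"
        using algebraic_int_plus_times(2) by (metis mult.assoc)
      \<comment> \<open>The coprime multipliers \<open>r i\<close> and \<open>p\<close> both make
        \<open>w * ?\<sigma>\<close> integral. Afterwards 2 and the odd prime \<open>p\<close> do
        the same for \<open>b\<close>.\<close>
      hence w\<sigma>: "algebraic_int (w * ?\<sigma>)"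
        using algebraic_int_coprime_cancel[OF cop] p_mult[OF pw] by blast
      have "algebraic_int (2 * u + w * ?\<sigma>)"
        by (rule algebraic_int_plus_times(1)[OF u2 w\<sigma>])
      also have "2 * u + w * ?\<sigma> = of_nat 2 * b"
        by (simp add: b_eq w_def algebra_simps)
      finally have "algebraic_int (of_nat 2 * b)" .
      moreover have "coprime 2 p" using p(2) by simp
      ultimately show ?thesis
        using algebraic_int_coprime_cancel p_mult[OF pb] by blast
    qed
  qed
qed

text \<open>Induction on \<open>T\<close>. If \<open>x = a + b * s t\<close> is not already in the
  smaller field, the coefficient \<open>2 * a * b\<close> of \<open>s t\<close> in
  \<open>x\<^sup>2\<close> must vanish; \<open>b = 0\<close> is excluded, so \<open>a = 0\<close>,
  and \<open>x * s t\<close> lies in the smaller field.\<close>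

lemma square_in_multiquadratic:
  assumes K: "subfield_of_complex K" and T: "finite T"
    and sq: "\<And>t. t \<in> T \<Longrightarrow> (s t)\<^sup>2 \<in> K"
    and x: "x \<in> adjoin K (s ` T)" "x\<^sup>2 \<in> K"
  shows "\<exists>U\<subseteq>T. \<exists>y\<in>K. x\<^sup>2 * (\<Prod>t\<in>U. (s t)\<^sup>2) = y\<^sup>2"
  using T sq x
proof (induction T arbitrary: x rule: finite_induct)
  case empty
  thus ?case by (auto simp: adjoin_empty[OF K])
next
  case (insert t T)
  let ?E = "adjoin K (s ` T)"
  have E: "subfield_of_complex ?E" by (rule subfield_adjoin)
  have st: "(s t)\<^sup>2 \<in> K" using insert.prems(1) by simp
  have sub: "K \<subseteq> ?E" using adjoin_incl[of K "s ` T"] by auto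
  have IH: "\<exists>U\<subseteq>T. \<exists>y\<in>K. z\<^sup>2 * (\<Prod>t\<in>U. (s t)\<^sup>2) = y\<^sup>2" if "z \<in> ?E" "z\<^sup>2 \<in> K" for z
    using insert.IH[of z] insert.prems(1) that by auto
  show ?case
  proof (cases "x \<in> ?E")
    case True
    thus ?thesis using IH[of x] insert.prems(3) by blast
  next
    case False
    hence nst: "s t \<notin> ?E"
      using insert.prems(2) adjoin_absorb[of "s t"] by auto
    obtain a b where ab: "a \<in> ?E" "b \<in> ?E" "x = a + b * s t"
      using insert.prems(2) adjoin_insert_quadratic[OF st, of "s ` T"] by auto
    have "(a\<^sup>2 + b\<^sup>2 * (s t)\<^sup>2 - x\<^sup>2) + (2 * a * b) * s t = 0"
      by (simp add: ab(3) power2_eq_square algebra_simps)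
    moreover have "(s t)\<^sup>2 \<in> ?E" "x\<^sup>2 \<in> ?E"
      using sub st insert.prems(3) by auto
    hence "a\<^sup>2 + b\<^sup>2 * (s t)\<^sup>2 - x\<^sup>2 \<in> ?E" "2 * a * b \<in> ?E"
      using ab(1,2) by (simp_all add: subfield_closed[OF E])
    ultimately have "2 * a * b = 0"
      using subfield_quadratic_coeffs[OF E nst] by blast
    hence "a = 0" using False ab by auto
    \<comment> \<open>As \<open>a = 0\<close>, this is \<open>x * s t\<close>. The factor
      \<open>(s t)\<^sup>2\<close> gained by squaring is what adds \<open>t\<close> to the subset
      found for \<open>z\<close>.\<close>
    define z where "z = b * (s t)\<^sup>2"
    have z2: "z\<^sup>2 = x\<^sup>2 * (s t)\<^sup>2"
      by (simp add: z_def ab(3) \<open>a = 0\<close> power2_eq_square)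
    have "z \<in> ?E" "z\<^sup>2 \<in> K"
      unfolding z2 using ab(2) sub st insert.prems(3)
      by (auto simp: z_def intro!: subfield_mult[OF E] subfield_mult[OF K])
    then obtain U y where U: "U \<subseteq> T" "y \<in> K" "z\<^sup>2 * (\<Prod>t\<in>U. (s t)\<^sup>2) = y\<^sup>2"
      using IH by blast
    have "finite U" "t \<notin> U" using U(1) insert.hyps finite_subset by auto
    hence "x\<^sup>2 * (\<Prod>t\<in>insert t U. (s t)\<^sup>2) = y\<^sup>2"
      using U(3) by (simp add: z2 mult.assoc)
    thus ?thesis using U(1,2) by (intro exI[of _ "insert t U"]) auto
  qed
qed

text \<open>The inverse of \<open>\<sigma>\<close> would violate non-ramification: \<open>p\<close>
  times its square is 1, so it would be integral, and then \<open>1 / p\<close> would be an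
  integer.\<close>

lemma sqrt_prime_notin:
  fixes s :: "'i \<Rightarrow> complex" and r :: "'i \<Rightarrow> nat"
  assumes p: "Factorial_Ring.prime p" "odd p" and U: "finite U"
    and r: "\<And>i. i \<in> U \<Longrightarrow> (s i)\<^sup>2 = of_nat (r i) \<and> coprime (r i) p"
    and \<sigma>: "\<sigma>\<^sup>2 = of_nat p"
  shows "\<sigma> \<notin> adjoin \<rat> (s ` U)"
proof
  assume "\<sigma> \<in> adjoin \<rat> (s ` U)"
  hence "inverse \<sigma> \<in> adjoin \<rat> (s ` U)"
    by (rule subfield_inverse[OF subfield_adjoin])
  moreover have p0: "p > 1" using p(1) by (rule prime_gt_1_nat)
  hence 1: "of_nat p * (inverse \<sigma>)\<^sup>2 = 1"
    by (simp add: power_inverse \<sigma>)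
  ultimately have "algebraic_int (inverse \<sigma>)"
    using unramified_prime_cancel[OF p U r, where b = "inverse \<sigma>"] by simp
  hence "algebraic_int (inverse \<sigma> * inverse \<sigma>)"
    by (intro algebraic_int_plus_times)
  hence "algebraic_int (inverse (of_nat p) :: complex)"
    by (simp add: \<sigma>[symmetric] power2_eq_square)
  hence "(inverse (of_nat p) :: complex) \<in> \<int>"
    by (rule rational_algebraic_int_is_int) simp
  then obtain k where "inverse (of_nat p :: complex) = of_int k"
    by (auto elim: Ints_cases)
  hence "of_int (int p * k) = (1 :: complex)"
    using p0 by (simp add: field_simps)
  hence "int p * k = 1" by (simp only: of_int_eq_1_iff)
  thus False using p0 zmult_eq_1_iff[of "int p" k] by auto
qed

subsection \<open>Independence of unit square classes\<close>

context
  fixes L :: "complex set"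
  assumes L: "subfield_of_complex L"
begin

lemma integer_ring_simps [simp]:
  "carrier (integer_ring L) = integers_of L" "x \<otimes>\<^bsub>integer_ring L\<^esub> y = x * y"
  "x \<oplus>\<^bsub>integer_ring L\<^esub> y = x + y" "\<one>\<^bsub>integer_ring L\<^esub> = 1" "\<zero>\<^bsub>integer_ring L\<^esub> = 0"
  by (simp_all add: integer_ring_def)

lemma cring_integer_ring: "cring (integer_ring L)"
proof (rule cringI)
  show "abelian_group (integer_ring L)"
    by (rule abelian_groupI)
       (auto simp: integers_of_closed[OF L] intro!: bexI[of _ "- _"] integers_of_closed(4)[OF L])
  show "comm_monoid (integer_ring L)"
    by (rule comm_monoidI) (auto simp: integers_of_closed[OF L])
qed (auto simp: algebra_simps)

lemma Units_integer_ring: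
  "u \<in> Units (integer_ring L) \<longleftrightarrow> u \<in> integers_of L \<and> (\<exists>v\<in>integers_of L. v * u = 1)"
  by (auto simp: Units_def mult.commute)

text \<open>This brings independence of the classes into the form that Kummer theory meets, where
  the square root \<open>y\<close> is only known to lie in the field. A square root in
  \<open>L\<close> of a unit is again a unit, so the product is trivial modulo unit squares and all
  exponents vanish.\<close>

lemma Z2_independent_units_prod_eq_square:
  assumes indep: "Z2_independent_family (unit_square_classes (integer_ring L)) S
      (\<lambda>w. unit_squares (integer_ring L) #>\<^bsub>units_of (integer_ring L)\<^esub> w)"
    and S: "finite S" "S \<subseteq> Units (integer_ring L)"
    and U: "U \<subseteq> S" and y: "y \<in> L" "(\<Prod>w\<in>U. w) = y\<^sup>2"
  shows "U = {}"
proof -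
  let ?R = "integer_ring L"
  let ?U = "units_of ?R" and ?Q = "unit_squares ?R" and ?V = "unit_square_classes ?R"
  interpret R: cring ?R by (rule cring_integer_ring)
  interpret U: comm_group ?U by (rule R.units_comm_group)
  interpret V: comm_group ?V by (rule unit_square_classes_vector_space(1)[OF cring_integer_ring])
  have carr: "carrier ?U = Units ?R" by (simp add: units_of_def)
  have mult: "x \<otimes>\<^bsub>?U\<^esub> z = x * z" and one: "\<one>\<^bsub>?U\<^esub> = 1" for x z
    by (simp_all add: units_of_def)
  have sq: "u [^]\<^bsub>?U\<^esub> (2::nat) = u\<^sup>2" for u
    by (simp add: numeral_2_eq_2 mult one)
  have "(\<lambda>u. u [^]\<^bsub>?U\<^esub> (2::nat)) \<in> hom ?U ?U"
    by (auto simp: hom_def U.pow_mult_distrib U.m_comm)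
  then interpret h: group_hom ?U ?U "\<lambda>u. u [^]\<^bsub>?U\<^esub> (2::nat)"
    by unfold_locales
  have sub: "subgroup ?Q ?U"
    unfolding unit_squares_def by (rule h.img_is_subgroup)
  interpret Q: normal ?Q ?U using sub by (rule U.subgroup_imp_normal)
  have V_mult: "A \<otimes>\<^bsub>?V\<^esub> B = A <#>\<^bsub>?U\<^esub> B" and V_one: "\<one>\<^bsub>?V\<^esub> = ?Q" for A B
    by (simp_all add: unit_square_classes_def FactGroup_def)
  have Q_one: "?Q #>\<^bsub>?U\<^esub> 1 = ?Q"
    using U.coset_mult_one[of ?Q] Q.subset by (simp add: one)
  have V_carr: "?Q #>\<^bsub>?U\<^esub> u \<in> carrier ?V" if "u \<in> Units ?R" for u
    using that by (auto simp: unit_square_classes_def FactGroup_def RCOSETS_def carr)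
  \<comment> \<open>The coset map respects finite products. Membership in the unit group is carried
    along because multiplying cosets requires it.\<close>
  have prod_class: "(\<Prod>w\<in>A. g w) \<in> Units ?R \<and>
      (\<Otimes>\<^bsub>?V\<^esub>w\<in>A. (?Q #>\<^bsub>?U\<^esub> g w)) = ?Q #>\<^bsub>?U\<^esub> (\<Prod>w\<in>A. g w)"
    if "finite A" "\<forall>w\<in>A. g w \<in> Units ?R" for A and g :: "complex \<Rightarrow> complex"
    using that
  proof (induction A rule: finite_induct)
    case empty
    show ?case using R.Units_one_closed by (simp add: V_one Q_one)
  next
    case (insert a A)
    have "g a * (\<Prod>w\<in>A. g w) \<in> Units ?R"
      using insert R.Units_m_closed[of "g a" "\<Prod>w\<in>A. g w"] by simp
    moreover have "(?Q #>\<^bsub>?U\<^esub> g a) <#>\<^bsub>?U\<^esub> (?Q #>\<^bsub>?U\<^esub> (\<Prod>w\<in>A. g w)) =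
        ?Q #>\<^bsub>?U\<^esub> (g a * (\<Prod>w\<in>A. g w))"
      using insert by (subst Q.rcos_sum) (auto simp: carr mult)
    ultimately show ?case
      using insert by (simp add: V.finprod_insert V_carr Pi_iff V_mult)
  qed
  \<comment> \<open>The exponents are the indicator of \<open>U\<close>, and \<open>g w\<close> is
    \<open>w\<close> to the power \<open>c w\<close>; this extends the product over \<open>U\<close>
    to all of \<open>S\<close>.\<close>
  define c where "c = (\<lambda>w. if w \<in> U then 1 else 0 :: nat)"
  define g where "g = (\<lambda>w. if w \<in> U then w else 1 :: complex)"
  have g: "\<forall>w\<in>S. g w \<in> Units ?R"
    using S(2) R.Units_one_closed by (auto simp: g_def)
  have g_prod: "(\<Prod>w\<in>S. g w) = y\<^sup>2"
    using U S(1) y(2) unfolding g_def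
    by (subst prod.inter_restrict[symmetric]) (auto simp: Int_absorb1)
  have y2: "y\<^sup>2 \<in> Units ?R"
    using prod_class[OF S(1) g] g_prod by simp
  have "algebraic_int y"
    using y2 by (intro algebraic_int_of_power[of y 2]) (auto simp: Units_integer_ring integers_of_def)
  hence yO: "y \<in> integers_of L" using y(1) by (simp add: integers_of_def)
  \<comment> \<open>If \<open>v\<close> inverts \<open>y\<^sup>2\<close>, then \<open>v * y\<close>
    inverts \<open>y\<close>.\<close>
  obtain v where "v \<in> integers_of L" "v * y\<^sup>2 = 1"
    using y2 by (auto simp: Units_integer_ring)
  hence "v * y \<in> integers_of L \<and> (v * y) * y = 1"
    using yO integers_of_closed(3)[OF L] by (simp add: power2_eq_square mult.assoc)
  hence "y \<in> Units ?R"
    using yO by (auto simp: Units_integer_ring)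
  hence y2Q: "y\<^sup>2 \<in> ?Q"
    unfolding unit_squares_def sq carr by blast
  have "(\<Otimes>\<^bsub>?V\<^esub>w\<in>S. (?Q #>\<^bsub>?U\<^esub> w) [^]\<^bsub>?V\<^esub> c w) = (\<Otimes>\<^bsub>?V\<^esub>w\<in>S. (?Q #>\<^bsub>?U\<^esub> g w))"
  proof (rule V.finprod_cong')
    fix w assume w: "w \<in> S"
    show "(?Q #>\<^bsub>?U\<^esub> w) [^]\<^bsub>?V\<^esub> c w = ?Q #>\<^bsub>?U\<^esub> g w"
    proof (cases "w \<in> U")
      case True
      have "?Q #>\<^bsub>?U\<^esub> w \<in> carrier ?V" using w S(2) V_carr by auto
      thus ?thesis using True V.nat_pow_eone by (simp only: c_def g_def if_True)
    next
      case False
      thus ?thesis by (simp only: c_def g_def if_False V.nat_pow_0 V_one Q_one)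
    qed
  qed (use g V_carr in auto)
  also have "\<dots> = ?Q #>\<^bsub>?U\<^esub> y\<^sup>2"
    using prod_class[OF S(1) g] g_prod by simp
  also have "\<dots> = \<one>\<^bsub>?V\<^esub>"
    unfolding V_one using y2Q y2 by (intro U.coset_join2[OF _ sub]) (auto simp: carr)
  finally have "(\<Otimes>\<^bsub>?V\<^esub>w\<in>S. (?Q #>\<^bsub>?U\<^esub> w) [^]\<^bsub>?V\<^esub> c w) = \<one>\<^bsub>?V\<^esub>" .
  moreover have "c \<in> S \<rightarrow> {0, 1}" by (simp add: c_def)
  ultimately have "\<forall>w\<in>S. c w = 0"
    using indep unfolding Z2_independent_family_def by blast
  thus ?thesis using U by (auto simp: c_def split: if_splits)
qed

end

section \<open>Integral bases of \<open>L\<close> and \<open>N\<close>\<close>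

lemma algebraic_int_half_one_plus:
  fixes s :: complex
  assumes "s\<^sup>2 = 1 + 4 * a" "algebraic_int a"
  shows "algebraic_int ((1 + s) / 2)"
proof (rule algebraic_int_of_mult_pred)
  \<comment> \<open>The right-hand side is \<open>a\<close>, so \<open>(1 + s) / 2\<close> is a root
    of \<open>X\<^sup>2 - X - a\<close>.\<close>
  have "(1 + s) / 2 * ((1 + s) / 2 - 1) = (s\<^sup>2 - 1) / 4"
    by (simp add: field_simps power2_eq_square)
  thus "algebraic_int ((1 + s) / 2 * ((1 + s) / 2 - 1))"
    using assms by simp
qed

theorem theorem2p9:
  fixes l :: nat and p :: "nat \<Rightarrow> nat"
    and L N S0 :: "complex set"
    and rt :: "complex \<Rightarrow> complex"
    and lam :: "nat set \<Rightarrow> complex"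
    and eta :: "complex set \<Rightarrow> complex"
  assumes p_prime: "\<And>i. i \<in> {1..l} \<Longrightarrow> Factorial_Ring.prime (p i) \<and> p i mod 4 = 1"
    and p_distinct: "inj_on p {1..l}"
    and L_def: "L = adjoin \<rat> ((\<lambda>i. complex_of_real (sqrt (real (p i)))) ` {1..l})"
    and S0_finite: "finite S0"
    and S0_units: "S0 \<subseteq> Units (integer_ring L) \<inter> {1 + 4 * a | a. a \<in> integers_of L}"
    and S0_independent:
      "Z2_independent_family (unit_square_classes (integer_ring L)) S0
         (\<lambda>w. unit_squares (integer_ring L) #>\<^bsub>units_of (integer_ring L)\<^esub> w)"
    and rt: "\<And>w. w \<in> S0 \<Longrightarrow> (rt w)\<^sup>2 = w"
    and N_def: "N = adjoin L (rt ` S0)"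
    and lam_def: "\<And>D. lam D = (\<Prod>i\<in>D. (1 + complex_of_real (sqrt (real (p i)))) / 2)"
    and eta_def: "\<And>T. eta T = (\<Prod>w\<in>T. (1 + rt w) / 2)"
  shows "basis_family \<int> (integers_of L) (Pow {1..l}) lam
    \<and> basis_family (integers_of L) (integers_of N) (Pow S0) eta
    \<and> basis_family \<int> (integers_of N) (Pow S0 \<times> Pow {1..l}) (\<lambda>(T, D). eta T * lam D)"
proof -
  let ?s = "\<lambda>i. complex_of_real (sqrt (real (p i)))"
  have s2: "(?s i)\<^sup>2 = of_nat (p i)" for i
    by (simp flip: of_real_power)
  have odd: "odd (p i)" if "i \<in> {1..l}" for i
    using conjunct2[OF p_prime[OF that]] by presburger
  have cop: "coprime (p i) (p j)" if "i \<in> {1..l}" "j \<in> {1..l}" "i \<noteq> j" for i j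
    using p_prime[OF that(1)] p_prime[OF that(2)] p_distinct that
    by (intro primes_coprime) (auto simp: inj_on_eq_iff)
  have fin: "finite U" if "U \<subseteq> {1..l}" for U
    using that finite_subset by blast
  have L: "subfield_of_complex L"
    unfolding L_def by (rule subfield_adjoin)
  have lam: "lam = (\<lambda>D. \<Prod>i\<in>D. (1 + ?s i) / 2)" and eta: "eta = (\<lambda>T. \<Prod>w\<in>T. (1 + rt w) / 2)"
    using lam_def eta_def by auto

  have "basis_family (integers_of \<rat>) (integers_of L) (Pow {1..l}) lam"
    unfolding L_def lam
  proof (rule multiquadratic_integral_basis[OF subfield_Rats])
    fix i assume i: "i \<in> {1..l}"
    show "(?s i)\<^sup>2 \<in> \<rat>" by (simp add: s2)
    have "p i = 1 + 4 * (p i div 4)"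
      using conjunct2[OF p_prime[OF i]] by presburger
    hence "(?s i)\<^sup>2 = 1 + 4 * of_nat (p i div 4)"
      by (metis s2 of_nat_1 of_nat_add of_nat_mult of_nat_numeral)
    thus "algebraic_int ((1 + ?s i) / 2)"
      by (rule algebraic_int_half_one_plus) simp
  next
    fix U i assume U: "U \<subseteq> {1..l}" and i: "i \<in> {1..l} - U"
    \<comment> \<open>The roots in \<open>U\<close> belong to primes other than \<open>p i\<close>,
      so non-ramification at \<open>p i\<close> yields both independence and cancellation.\<close>
    have *: "Factorial_Ring.prime (p i)" "odd (p i)"
      "\<And>j. j \<in> U \<Longrightarrow> (?s j)\<^sup>2 = of_nat (p j) \<and> coprime (p j) (p i)"
      using p_prime[of i] odd[of i] i cop s2 U by (simp, simp, blast)
    show "?s i \<notin> adjoin \<rat> (?s ` U)"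
      using * fin[OF U] s2 by (intro sqrt_prime_notin[of "p i" U ?s p]) auto
    show "algebraic_int b" if "b \<in> adjoin \<rat> (?s ` U)" "algebraic_int (b\<^sup>2 * (?s i)\<^sup>2)" for b
      using that unramified_prime_cancel[OF *(1,2) fin[OF U] *(3) that(1)]
      by (simp add: s2 mult.commute)
  qed simp
  hence 1: "basis_family \<int> (integers_of L) (Pow {1..l}) lam"
    by (simp only: integers_of_Rats)

  have unit: "w \<in> Units (integer_ring L)" and w_int: "\<exists>a\<in>integers_of L. w = 1 + 4 * a"
    if "w \<in> S0" for w
    using that S0_units by auto
  have w_L: "w \<in> L" if "w \<in> S0" for w
    using unit[OF that] Units_integer_ring[OF L] by (simp add: integers_of_def)
  have 2: "basis_family (integers_of L) (integers_of N) (Pow S0) eta"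
    unfolding N_def eta
  proof (rule multiquadratic_integral_basis[OF L S0_finite])
    fix w assume w: "w \<in> S0"
    show "(rt w)\<^sup>2 \<in> L" by (simp add: rt[OF w] w_L[OF w])
    show "algebraic_int ((1 + rt w) / 2)"
      using w_int[OF w] algebraic_int_half_one_plus[of "rt w"] rt[OF w]
      by (auto simp: integers_of_def)
  next
    fix U w assume U: "U \<subseteq> S0" and w: "w \<in> S0 - U"
    have rt_w: "(rt w)\<^sup>2 = w" using rt w by auto
    show "rt w \<notin> adjoin L (rt ` U)"
    proof
      \<comment> \<open>Kummer theory makes \<open>w\<close> times the product over some subset
        \<open>U'\<close> of \<open>U\<close> a square in \<open>L\<close>. As \<open>w\<close> is
        not in \<open>U'\<close>, this is a product over the nonempty set
        \<open>insert w U'\<close>, against independence.\<close>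
      assume *: "rt w \<in> adjoin L (rt ` U)"
      have "\<exists>U'\<subseteq>U. \<exists>y\<in>L. (rt w)\<^sup>2 * (\<Prod>t\<in>U'. (rt t)\<^sup>2) = y\<^sup>2"
      proof (rule square_in_multiquadratic[OF L _ _ *])
        show "finite U" using U S0_finite finite_subset by blast
        show "(rt w)\<^sup>2 \<in> L" using rt_w w w_L by auto
        show "(rt t)\<^sup>2 \<in> L" if "t \<in> U" for t
          using that U rt[of t] w_L[of t] by auto
      qed
      then obtain U' y where U': "U' \<subseteq> U" "y \<in> L" "(rt w)\<^sup>2 * (\<Prod>t\<in>U'. (rt t)\<^sup>2) = y\<^sup>2"
        by blast
      have "finite U'" "w \<notin> U'" "(\<Prod>t\<in>U'. (rt t)\<^sup>2) = (\<Prod>t\<in>U'. t)"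
        using U' U w rt S0_finite by (auto intro!: prod.cong intro: finite_subset)
      hence "(\<Prod>t\<in>insert w U'. t) = y\<^sup>2"
        using U'(3) by (simp add: rt_w)
      hence "insert w U' = {}"
        using U U' w S0_units
        by (intro Z2_independent_units_prod_eq_square[OF L S0_independent S0_finite _ _ U'(2)]) auto
      thus False by simp
    qed
    fix b assume b: "algebraic_int (b\<^sup>2 * (rt w)\<^sup>2)"
    \<comment> \<open>Here \<open>w\<close> is a unit, and its inverse \<open>v\<close> removes the
      factor \<open>(rt w)\<^sup>2\<close> within the algebraic integers.\<close>
    obtain v where v: "v \<in> integers_of L" "v * w = 1"
      using unit[of w] w Units_integer_ring[OF L] by auto
    have "algebraic_int ((b\<^sup>2 * (rt w)\<^sup>2) * v)"
      using v by (intro algebraic_int_plus_times b) (simp add: integers_of_def)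
    also have "(b\<^sup>2 * (rt w)\<^sup>2) * v = b\<^sup>2"
      using v(2) by (simp add: rt_w mult.assoc mult.commute)
    finally show "algebraic_int b"
      by (rule algebraic_int_of_power) simp
  qed

  have N: "subfield_of_complex N" and LN: "L \<subseteq> N"
    using subfield_adjoin[of L "rt ` S0"] adjoin_incl[of L "rt ` S0"] by (auto simp: N_def)
  have "basis_family \<int> (integers_of N) (Pow S0 \<times> Pow {1..l}) (\<lambda>(T, D). eta T * lam D)"
  proof (rule basis_family_trans[OF 1 2])
    show "r * x \<in> integers_of L" if "r \<in> \<int>" "x \<in> integers_of L" for r x
      using that integers_of_closed(3,7)[OF L] by (auto elim!: Ints_cases)
    show "m * x \<in> integers_of N" if "m \<in> integers_of L" "x \<in> integers_of N" for m x
      using that LN by (intro integers_of_closed(3)[OF N]) (auto simp: integers_of_def)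
  qed (use integers_of_closed[OF L] in auto)
  thus ?thesis using 1 2 by blast
qed

end
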